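(* Let $\mathcal G$ be a hereditary graph class. The following are equivalent: (1) $\mathcal G$ has clique-bounded vertex cover number; (2) $\mathcal G$ has bounded $\alpha$-vertex cover number; (3) there exists a positive integer $n$ such that neither $nK_2$ nor $K_{n,n}$ belongs to $\mathcal G$.
   Context: All graphs are finite, simple and undirected; $\alpha,\omega$ denote independence and clique number. A hereditary graph class is a set of graphs closed under isomorphism and taking induced subgraphs. $nK_2$ is the disjoint union of $n$ edges; $K_{n,n}$ is the complete bipartite graph with parts of size $n$. $\mathrm{vc}(G)$ is the minimum size of a vertex cover (a vertex set meeting every edge) of $G$, and $\alpha\text{-}\mathrm{vc}(G)$ is the minimum of $\alpha(G[S])$ over all vertex covers $S$ of $G$. $\mathcal G$ has clique-bounded $\mathrm{vc}$ if there is a nondecreasing $f$ with $\mathrm{vc}(G')\le f(\omega(G'))$ for every induced subgraph $G'$ of every $G\in\mathcal G$; it has bounded $\alpha\text{-}\mathrm{vc}$ if there is an integer $k$ with $\alpha\text{-}\mathrm{vc}(G')\le k$ for all such $G'$. *)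

theory Defs
  imports Main
begin

text \<open>A graph is a pair of a vertex set and a set of edges, an edge being a two-element set
  of vertices.\<close>

type_synonym 'a graph = "'a set \<times> 'a set set"

abbreviation verts :: "'a graph \<Rightarrow> 'a set" where
  "verts G \<equiv> fst G"

abbreviation edges :: "'a graph \<Rightarrow> 'a set set" where
  "edges G \<equiv> snd G"

definition simple_graph :: "'a graph \<Rightarrow> bool" where
  "simple_graph G \<longleftrightarrow> finite (verts G) \<and> (\<forall>e\<in>edges G. e \<subseteq> verts G \<and> card e = 2)"

definition induced :: "'a graph \<Rightarrow> 'a set \<Rightarrow> 'a graph" where
  "induced G S = (S, {e \<in> edges G. e \<subseteq> S})"

definition induced_subgraph :: "'a graph \<Rightarrow> 'a graph \<Rightarrow> bool" where
  "induced_subgraph H G \<longleftrightarrow> (\<exists>S\<subseteq>verts G. H = induced G S)"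

definition graph_iso :: "'a graph \<Rightarrow> 'b graph \<Rightarrow> bool" where
  "graph_iso G H \<longleftrightarrow> (\<exists>f. bij_betw f (verts G) (verts H) \<and>
     (\<forall>x\<in>verts G. \<forall>y\<in>verts G. {x, y} \<in> edges G \<longleftrightarrow> {f x, f y} \<in> edges H))"

definition independent :: "'a graph \<Rightarrow> 'a set \<Rightarrow> bool" where
  "independent G S \<longleftrightarrow> S \<subseteq> verts G \<and> (\<forall>x\<in>S. \<forall>y\<in>S. {x, y} \<notin> edges G)"

definition clique :: "'a graph \<Rightarrow> 'a set \<Rightarrow> bool" where
  "clique G S \<longleftrightarrow> S \<subseteq> verts G \<and> (\<forall>x\<in>S. \<forall>y\<in>S. x \<noteq> y \<longrightarrow> {x, y} \<in> edges G)"

definition vertex_cover :: "'a graph \<Rightarrow> 'a set \<Rightarrow> bool" where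
  "vertex_cover G S \<longleftrightarrow> S \<subseteq> verts G \<and> (\<forall>e\<in>edges G. e \<inter> S \<noteq> {})"

text \<open>The maxima and minima below are over finite nonempty sets whenever the graph is simple:
  the empty set is independent and a clique, and the vertex set is a vertex cover.\<close>

definition independence_number :: "'a graph \<Rightarrow> nat" where
  "independence_number G = Max {card S |S. independent G S}"

definition clique_number :: "'a graph \<Rightarrow> nat" where
  "clique_number G = Max {card S |S. clique G S}"

definition vc :: "'a graph \<Rightarrow> nat" where
  "vc G = Min {card S |S. vertex_cover G S}"

definition alpha_vc :: "'a graph \<Rightarrow> nat" where
  "alpha_vc G = Min {independence_number (induced G S) |S. vertex_cover G S}"

definition hereditary :: "'a graph set \<Rightarrow> bool" where
  "hereditary \<G> \<longleftrightarrow>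
     (\<forall>G\<in>\<G>. simple_graph G) \<and>
     (\<forall>G\<in>\<G>. \<forall>H. simple_graph H \<and> graph_iso G H \<longrightarrow> H \<in> \<G>) \<and>
     (\<forall>G\<in>\<G>. \<forall>H. induced_subgraph H G \<longrightarrow> H \<in> \<G>)"

definition clique_bounded_vc :: "'a graph set \<Rightarrow> bool" where
  "clique_bounded_vc \<G> \<longleftrightarrow>
     (\<exists>f :: nat \<Rightarrow> nat. mono f \<and>
        (\<forall>G\<in>\<G>. \<forall>H. induced_subgraph H G \<longrightarrow> vc H \<le> f (clique_number H)))"

definition bounded_alpha_vc :: "'a graph set \<Rightarrow> bool" where
  "bounded_alpha_vc \<G> \<longleftrightarrow>
     (\<exists>k :: nat. \<forall>G\<in>\<G>. \<forall>H. induced_subgraph H G \<longrightarrow> alpha_vc H \<le> k)"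

text \<open>Concrete copies on \<open>{0..<2 * n}\<close>. In a class of graphs on natural numbers that is closed
  under isomorphism, containing such a copy is the same as containing any isomorphic graph.\<close>

definition nK2 :: "nat \<Rightarrow> nat graph" where
  "nK2 n = ({..<2 * n}, {{2 * i, 2 * i + 1} |i. i < n})"

definition Knn :: "nat \<Rightarrow> nat graph" where
  "Knn n = ({..<2 * n}, {{i, n + j} |i j. i < n \<and> j < n})"

lemma simple_graph_nK2: "simple_graph (nK2 n)"
  by (auto simp: simple_graph_def nK2_def)

lemma simple_graph_Knn: "simple_graph (Knn n)"
  by (auto simp: simple_graph_def Knn_def card_2_iff)

end

(* (1) implies (3) because every vertex cover of nK2 and of K_{n,n} has at least n vertices,
   while these graphs have clique number at most 2.  Ramsey's theorem bounds the size of a graph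
   in terms of its independence and clique numbers, so (2) implies (1).
   For (3) implies (2), let I be a maximum independent set; its complement is a vertex cover.
   If J is independent and disjoint from I, then a maximal matching between J and I has at least
   card J / 2 edges, for otherwise exchanging the unmatched vertices of J with the matched
   vertices of I would enlarge I.  Two applications of Ramsey's theorem to the edges
   a_0 b_0, a_1 b_1, ... of a large matching between two independent sets, colouring
   i < j by the adjacency of a_i and b_j and by that of a_j and b_i, produce an induced
   K_{n,n} or nK2. *)

theory Submission
  imports "HOL-Library.Ramsey" Defs
begin

section \<open>Ramsey's theorem along increasing index sequences\<close>

text \<open>A homogeneous set is listed in increasing order, so \<open>P\<close> need not be
  symmetric: each pair is coloured by \<open>P\<close> from its smaller to its larger element.
  Increasing selections compose, so a second relation can be made homogeneous without spoiling the
  first.\<close>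

lemma ramsey_strict_mono:
  fixes m :: nat
  obtains N :: nat where "\<And>P :: nat \<Rightarrow> nat \<Rightarrow> bool. \<exists>k.
    strict_mono_on {..<m} k \<and> k ` {..<m} \<subseteq> {..<N} \<and>
    ((\<forall>i j. i < j \<and> j < m \<longrightarrow> P (k i) (k j)) \<or> (\<forall>i j. i < j \<and> j < m \<longrightarrow> \<not> P (k i) (k j)))"
proof -
  obtain N where N: "\<And>(V::nat set) (E::nat set set). finite V \<and> card V \<ge> N \<Longrightarrow>
      (\<exists>R \<subseteq> V. card R = m \<and> Ramsey.clique R E \<or> card R = m \<and> indep R E)"
    using ramsey2[of m m] by metis
  show ?thesis
  proof (rule that)
    fix P :: "nat \<Rightarrow> nat \<Rightarrow> bool"
    define E where "E = {{i, j} |i j. i < j \<and> P i j}"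
    have E: "{i, j} \<in> E \<longleftrightarrow> P i j" if "i < j" for i j
      using that by (auto simp: E_def doubleton_eq_iff)
    obtain R where R: "R \<subseteq> {..<N}" "card R = m" "Ramsey.clique R E \<or> indep R E"
      using N[of "{..<N}" E] by auto
    obtain k where bij: "bij_betw k {..<m} R" and mono: "strict_mono_on {..<m} k"
      using ex_bij_betw_strict_mono_card[of R] R finite_subset by blast
    have less: "k i < k j \<and> k i \<in> R \<and> k j \<in> R" if "i < j" "j < m" for i j
      using that mono bij by (auto simp: strict_mono_on_def bij_betw_def)
    have "(\<forall>i j. i < j \<and> j < m \<longrightarrow> P (k i) (k j)) \<or> (\<forall>i j. i < j \<and> j < m \<longrightarrow> \<not> P (k i) (k j))"
      using R(3)
    proof
      assume "Ramsey.clique R E"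
      then show ?thesis
        unfolding Ramsey.clique_def using less E by (metis less_irrefl_nat)
    next
      assume "indep R E"
      then show ?thesis
        unfolding indep_def using less E by (metis less_irrefl_nat)
    qed
    then show "\<exists>k. strict_mono_on {..<m} k \<and> k ` {..<m} \<subseteq> {..<N} \<and>
      ((\<forall>i j. i < j \<and> j < m \<longrightarrow> P (k i) (k j)) \<or> (\<forall>i j. i < j \<and> j < m \<longrightarrow> \<not> P (k i) (k j)))"
      using bij mono R(1) by (auto simp: bij_betw_def)
  qed
qed

section \<open>Induced copies of \<open>nK2 n\<close> and \<open>Knn n\<close>\<close>

text \<open>Adjacency is both preserved and reflected, so \<open>H\<close> is isomorphic to an
  induced subgraph of \<open>G\<close>.\<close>

definition embeds :: "'a graph \<Rightarrow> 'b graph \<Rightarrow> bool" where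
  "embeds H G \<longleftrightarrow> (\<exists>g. inj_on g (verts H) \<and> g ` verts H \<subseteq> verts G \<and>
     (\<forall>x\<in>verts H. \<forall>y\<in>verts H. {x, y} \<in> edges H \<longleftrightarrow> {g x, g y} \<in> edges G))"

text \<open>The image of the embedding induces a subgraph of \<open>G\<close>, hence a member of the
  class, and the inverse of the embedding is an isomorphism from it onto \<open>H\<close>.\<close>

lemma hereditary_embeds:
  assumes "hereditary \<G>" "G \<in> \<G>" "simple_graph H" "embeds H G"
  shows "H \<in> \<G>"
proof -
  obtain g where g: "inj_on g (verts H)" "g ` verts H \<subseteq> verts G"
    "\<And>x y. x \<in> verts H \<Longrightarrow> y \<in> verts H \<Longrightarrow> {x, y} \<in> edges H \<longleftrightarrow> {g x, g y} \<in> edges G"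
    using assms(4) unfolding embeds_def by auto
  define K where "K = induced G (g ` verts H)"
  have "graph_iso K H"
    unfolding graph_iso_def
  proof (intro exI conjI ballI)
    show "bij_betw (inv_into (verts H) g) (verts K) (verts H)"
      using g(1) by (simp add: K_def induced_def inj_on_imp_bij_betw bij_betw_inv_into)
    fix x y assume "x \<in> verts K" "y \<in> verts K"
    then obtain u v where "x = g u" "y = g v" "u \<in> verts H" "v \<in> verts H"
      by (auto simp: K_def induced_def)
    then show "{x, y} \<in> edges K \<longleftrightarrow>
        {inv_into (verts H) g x, inv_into (verts H) g y} \<in> edges H"
      using g by (auto simp: K_def induced_def)
  qed
  moreover have "induced_subgraph K G"
    using g(2) by (auto simp: K_def induced_subgraph_def)
  ultimately show ?thesis
    using assms unfolding hereditary_def by blast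
qed

lemma edge_nK2_iff:
  assumes "x < 2 * n" "y < 2 * n"
  shows "{x, y} \<in> edges (nK2 n) \<longleftrightarrow> x \<noteq> y \<and> x div 2 = y div 2"
proof
  assume "{x, y} \<in> edges (nK2 n)"
  then show "x \<noteq> y \<and> x div 2 = y div 2"
    by (auto simp: nK2_def doubleton_eq_iff)
next
  assume *: "x \<noteq> y \<and> x div 2 = y div 2"
  define i where "i = x div 2"
  have "x = 2 * i \<and> y = 2 * i + 1 \<or> x = 2 * i + 1 \<and> y = 2 * i" "i < n"
    using * assms by (cases "even x"; cases "even y"; auto simp: i_def elim!: evenE oddE)+
  then show "{x, y} \<in> edges (nK2 n)"
    by (auto simp: nK2_def doubleton_eq_iff)
qed

lemma edge_Knn_iff:
  assumes "x < 2 * n" "y < 2 * n"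
  shows "{x, y} \<in> edges (Knn n) \<longleftrightarrow> (x < n \<longleftrightarrow> n \<le> y)"
proof
  assume "{x, y} \<in> edges (Knn n)"
  then show "x < n \<longleftrightarrow> n \<le> y"
    by (auto simp: Knn_def doubleton_eq_iff)
next
  assume *: "x < n \<longleftrightarrow> n \<le> y"
  show "{x, y} \<in> edges (Knn n)"
  proof (cases "x < n")
    case True
    then have "{x, y} = {x, n + (y - n)} \<and> x < n \<and> y - n < n"
      using * assms by auto
    then show ?thesis
      unfolding Knn_def by auto
  next
    case False
    then have "{x, y} = {y, n + (x - n)} \<and> y < n \<and> x - n < n"
      using * assms by auto
    then show ?thesis
      unfolding Knn_def by auto
  qed
qed

lemma strict_mono_on_eq_iff:
  fixes k :: "'a::linorder \<Rightarrow> 'b::preorder"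
  assumes "strict_mono_on A k" "i \<in> A" "j \<in> A"
  shows "k i = k j \<longleftrightarrow> i = j"
  using assms by (metis strict_mono_on_eqD)

text \<open>After two Ramsey selections, the adjacency of \<open>a i\<close> and \<open>b j\<close>
  for \<open>i \<noteq> j\<close> depends only on which index is smaller. If one of the two orders
  always gives an edge, the a's of one half of the indices and the b's of the other half form a
  \<open>Knn n\<close>; if neither does, only the matching edges remain.\<close>

lemma matching_embeds:
  obtains N :: nat where "\<And>(G :: 'a graph) a b. inj_on a {..<N} \<Longrightarrow> inj_on b {..<N} \<Longrightarrow>
     a ` {..<N} \<inter> b ` {..<N} = {} \<Longrightarrow> independent G (a ` {..<N}) \<Longrightarrow> independent G (b ` {..<N}) \<Longrightarrow>
     (\<And>i. i < N \<Longrightarrow> {a i, b i} \<in> edges G) \<Longrightarrow> embeds (nK2 n) G \<or> embeds (Knn n) G"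
proof -
  \<comment> \<open>Although each side of the target has \<open>n\<close> vertices,
    \<open>2 * n\<close> indices are kept: in the bipartite case the two sides use disjoint halves
    of them.\<close>
  obtain m where m: "\<And>P :: nat \<Rightarrow> nat \<Rightarrow> bool. \<exists>k.
    strict_mono_on {..<2 * n} k \<and> k ` {..<2 * n} \<subseteq> {..<m} \<and>
    ((\<forall>i j. i < j \<and> j < 2 * n \<longrightarrow> P (k i) (k j)) \<or> (\<forall>i j. i < j \<and> j < 2 * n \<longrightarrow> \<not> P (k i) (k j)))"
    using ramsey_strict_mono by blast
  obtain N where N: "\<And>P :: nat \<Rightarrow> nat \<Rightarrow> bool. \<exists>k.
    strict_mono_on {..<m} k \<and> k ` {..<m} \<subseteq> {..<N} \<and>
    ((\<forall>i j. i < j \<and> j < m \<longrightarrow> P (k i) (k j)) \<or> (\<forall>i j. i < j \<and> j < m \<longrightarrow> \<not> P (k i) (k j)))"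
    using ramsey_strict_mono by blast
  show ?thesis
  proof (rule that)
    fix G :: "'a graph" and a b
    assume a: "inj_on a {..<N}" and b: "inj_on b {..<N}"
      and ab: "a ` {..<N} \<inter> b ` {..<N} = {}"
      and ia: "independent G (a ` {..<N})" and ib: "independent G (b ` {..<N})"
      and e: "\<And>i. i < N \<Longrightarrow> {a i, b i} \<in> edges G"
    have in_verts: "a i \<in> verts G" "b i \<in> verts G" if "i < N" for i
      using that ia ib unfolding independent_def by auto
    have aa: "{a i, a j} \<notin> edges G" "{b i, b j} \<notin> edges G"
      "a i \<noteq> b j" "b j \<noteq> a i" "a i = a j \<longleftrightarrow> i = j" "b i = b j \<longleftrightarrow> i = j"
      if "i < N" "j < N" for i j
      using that ia ib ab inj_onD[OF a] inj_onD[OF b] unfolding independent_def by auto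
    obtain p where p: "strict_mono_on {..<m} p" "p ` {..<m} \<subseteq> {..<N}"
      and p_cases: "(\<forall>i j. i < j \<and> j < m \<longrightarrow> {a (p i), b (p j)} \<in> edges G) \<or>
        (\<forall>i j. i < j \<and> j < m \<longrightarrow> {a (p i), b (p j)} \<notin> edges G)"
      using N[of "\<lambda>i j. {a i, b j} \<in> edges G"] by blast
    obtain q where q: "strict_mono_on {..<2 * n} q" "q ` {..<2 * n} \<subseteq> {..<m}"
      and q_cases: "(\<forall>i j. i < j \<and> j < 2 * n \<longrightarrow> {a (p (q j)), b (p (q i))} \<in> edges G) \<or>
        (\<forall>i j. i < j \<and> j < 2 * n \<longrightarrow> {a (p (q j)), b (p (q i))} \<notin> edges G)"
      \<comment> \<open>The second colouring lives on the \<open>m\<close> indices selected by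
        \<open>p\<close> and has the roles of a and b exchanged.\<close>
      using m[of "\<lambda>i j. {a (p j), b (p i)} \<in> edges G"] by blast
    define k where "k i = p (q i)" for i
    have q_lt: "q i < m" if "i < 2 * n" for i
      using q(2) that by auto
    have k_lt: "k i < N" if "i < 2 * n" for i
      using p(2) q_lt[OF that] by (auto simp: k_def)
    have k_eq: "k i = k j \<longleftrightarrow> i = j" if "i < 2 * n" "j < 2 * n" for i j
      using strict_mono_on_eq_iff[OF p(1)] strict_mono_on_eq_iff[OF q(1)] that q_lt
      by (simp add: k_def)
    have q_less: "q i < q j" if "i < j" "j < 2 * n" for i j
      using q(1) that by (auto simp: strict_mono_on_def)
    \<comment> \<open>The first colouring stays homogeneous because \<open>q\<close> is
      increasing.\<close>
    have k1: "(\<forall>i j. i < j \<and> j < 2 * n \<longrightarrow> {a (k i), b (k j)} \<in> edges G) \<or>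
        (\<forall>i j. i < j \<and> j < 2 * n \<longrightarrow> {a (k i), b (k j)} \<notin> edges G)"
      using p_cases q_lt q_less unfolding k_def by blast
    have k2: "(\<forall>i j. i < j \<and> j < 2 * n \<longrightarrow> {a (k j), b (k i)} \<in> edges G) \<or>
        (\<forall>i j. i < j \<and> j < 2 * n \<longrightarrow> {a (k j), b (k i)} \<notin> edges G)"
      using q_cases unfolding k_def by blast
    have ba: "{b i, a j} = {a j, b i}" for i j
      by auto
    note facts = aa[OF k_lt k_lt] in_verts[OF k_lt] k_eq
    consider "\<forall>i j. i < j \<and> j < 2 * n \<longrightarrow> {a (k i), b (k j)} \<in> edges G"
      | "\<forall>i j. i < j \<and> j < 2 * n \<longrightarrow> {a (k j), b (k i)} \<in> edges G"
      | "\<forall>i j. i < j \<and> j < 2 * n \<longrightarrow> {a (k i), b (k j)} \<notin> edges G \<and> {a (k j), b (k i)} \<notin> edges G"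
      using k1 k2 by blast
    then show "embeds (nK2 n) G \<or> embeds (Knn n) G"
    proof cases
      case 1
      \<comment> \<open>Every a used has a smaller index than every b used, so all pairs across are
        edges.\<close>
      define g where "g i = (if i < n then a (k i) else b (k i))" for i
      have "inj_on g {..<2 * n}"
        unfolding inj_on_def g_def by (auto simp: facts split: if_splits)
      moreover have "{x, y} \<in> edges (Knn n) \<longleftrightarrow> {g x, g y} \<in> edges G"
        if "x < 2 * n" "y < 2 * n" for x y
        using that 1 by (auto simp: edge_Knn_iff g_def facts ba)
      ultimately show ?thesis
        unfolding embeds_def by (intro disjI2 exI[of _ g]) (auto simp: Knn_def g_def facts)
    next
      case 2
      \<comment> \<open>Here the edges need the larger index at a, so a takes the upper
        half.\<close>
      define g where "g i = (if i < n then b (k i) else a (k i))" for i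
      have "inj_on g {..<2 * n}"
        unfolding inj_on_def g_def by (auto simp: facts split: if_splits)
      moreover have "{x, y} \<in> edges (Knn n) \<longleftrightarrow> {g x, g y} \<in> edges G"
        if "x < 2 * n" "y < 2 * n" for x y
        using that 2 by (auto simp: edge_Knn_iff g_def facts ba)
      ultimately show ?thesis
        unfolding embeds_def by (intro disjI2 exI[of _ g]) (auto simp: Knn_def g_def facts)
    next
      case 3
      \<comment> \<open>The edge of \<open>2 * i\<close> and \<open>2 * i + 1\<close> is sent to the
        matching edge with index \<open>k i\<close>; parity selects the side.\<close>
      define g where "g i = (if even i then a (k (i div 2)) else b (k (i div 2)))" for i
      have h: "x div 2 < 2 * n" if "x < 2 * n" for x
        using that by auto
      have "inj_on g {..<2 * n}"
      proof (rule inj_onI)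
        fix x y assume "x \<in> {..<2 * n}" "y \<in> {..<2 * n}" "g x = g y"
        then have "even x = even y \<and> x div 2 = y div 2"
          using h[of x] h[of y]
          by (auto simp: g_def facts split: if_splits)
        then show "x = y"
          by presburger
      qed
      moreover have "{x, y} \<in> edges (nK2 n) \<longleftrightarrow> {g x, g y} \<in> edges G"
        if xy: "x < 2 * n" "y < 2 * n" for x y
      proof -
        have cross: "{a (k i), b (k j)} \<in> edges G \<longleftrightarrow> i = j" if "i < 2 * n" "j < 2 * n" for i j
          using 3 that e[OF k_lt] by (cases i j rule: linorder_cases) auto
        have "x \<noteq> y \<and> x div 2 = y div 2 \<longleftrightarrow> even x \<noteq> even y \<and> x div 2 = y div 2"
          by presburger
        then show ?thesis
          using h[OF xy(1)] h[OF xy(2)]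
          by (auto simp: edge_nK2_iff[OF xy] g_def facts ba cross)
      qed
      ultimately show ?thesis
        unfolding embeds_def by (intro disjI1 exI[of _ g]) (auto simp: nK2_def g_def facts)
    qed
  qed
qed

section \<open>Bounds and witnesses for the graph parameters\<close>

lemma induced_self: "simple_graph G \<Longrightarrow> induced G (verts G) = G"
  by (auto simp: simple_graph_def induced_def prod_eq_iff)

lemma independent_induced_iff:
  "S \<subseteq> verts G \<Longrightarrow> independent (induced G S) T \<longleftrightarrow> T \<subseteq> S \<and> independent G T"
  unfolding independent_def induced_def by simp blast

text \<open>This gives the finiteness of the sets whose \<open>Max\<close> or \<open>Min\<close>
  defines a parameter; \<open>f\<close> is \<open>card\<close> or the independence number of the
  induced subgraph.\<close>

lemma finite_image_Collect:
  assumes "finite V" "\<And>S. P S \<Longrightarrow> S \<subseteq> V"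
  shows "finite {f S |S. P S}"
proof -
  have "{f S |S. P S} \<subseteq> f ` Pow V"
    using assms(2) by auto
  then show ?thesis
    using assms(1) finite_subset by blast
qed

lemma finite_verts_induced:
  "finite (verts G) \<Longrightarrow> S \<subseteq> verts G \<Longrightarrow> finite (verts (induced G S))"
  by (auto simp: induced_def intro: finite_subset)

lemma card_le_independence_number:
  "finite (verts G) \<Longrightarrow> independent G T \<Longrightarrow> card T \<le> independence_number G"
  unfolding independence_number_def
  by (intro Max_ge finite_image_Collect[of "verts G" "independent G" card]) (auto simp: independent_def)

lemma independence_number_witness:
  assumes "finite (verts G)"
  obtains T where "independent G T" "card T = independence_number G"
proof -
  have "independence_number G \<in> {card S |S. independent G S}"
    unfolding independence_number_def using assms
    by (intro Max_in finite_image_Collect[of "verts G" "independent G" card]) (auto simp: independent_def)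
  then show ?thesis
    using that by auto
qed

lemma card_le_clique_number:
  "finite (verts G) \<Longrightarrow> Defs.clique G T \<Longrightarrow> card T \<le> clique_number G"
  unfolding clique_number_def
  by (intro Max_ge finite_image_Collect[of "verts G" "Defs.clique G" card]) (auto simp: Defs.clique_def)

lemma clique_number_witness:
  assumes "finite (verts G)"
  obtains T where "Defs.clique G T" "card T = clique_number G"
proof -
  have "clique_number G \<in> {card S |S. Defs.clique G S}"
    unfolding clique_number_def using assms
    by (intro Max_in finite_image_Collect[of "verts G" "Defs.clique G" card]) (auto simp: Defs.clique_def)
  then show ?thesis
    using that by auto
qed

lemma vertex_cover_verts:
  assumes "simple_graph G"
  shows "vertex_cover G (verts G)"
  unfolding vertex_cover_def
proof (intro conjI ballI order_refl)
  fix e assume "e \<in> edges G"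
  then have "e \<subseteq> verts G" "card e = 2"
    using assms by (auto simp: simple_graph_def)
  then show "e \<inter> verts G \<noteq> {}"
    by (auto simp: Int_absorb2)
qed

lemma vc_le: "finite (verts G) \<Longrightarrow> vertex_cover G S \<Longrightarrow> vc G \<le> card S"
  unfolding vc_def
  by (intro Min_le finite_image_Collect[of "verts G" "vertex_cover G" card]) (auto simp: vertex_cover_def)

lemma vc_witness:
  assumes "simple_graph G"
  obtains S where "vertex_cover G S" "card S = vc G"
proof -
  have "vc G \<in> {card S |S. vertex_cover G S}"
    unfolding vc_def using assms vertex_cover_verts[OF assms]
    by (intro Min_in finite_image_Collect[of "verts G" "vertex_cover G" card])
      (auto simp: vertex_cover_def simple_graph_def)
  then show ?thesis
    using that by auto
qed

lemma alpha_vc_le: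
  "finite (verts G) \<Longrightarrow> vertex_cover G S \<Longrightarrow> alpha_vc G \<le> independence_number (induced G S)"
  unfolding alpha_vc_def
  by (intro Min_le
      finite_image_Collect[of "verts G" "vertex_cover G" "\<lambda>S. independence_number (induced G S)"])
    (auto simp: vertex_cover_def)

lemma alpha_vc_witness:
  assumes "simple_graph G"
  obtains S where "vertex_cover G S" "independence_number (induced G S) = alpha_vc G"
proof -
  have "alpha_vc G \<in> {independence_number (induced G S) |S. vertex_cover G S}"
    unfolding alpha_vc_def using assms vertex_cover_verts[OF assms]
    by (intro Min_in
        finite_image_Collect[of "verts G" "vertex_cover G" "\<lambda>S. independence_number (induced G S)"])
      (auto simp: vertex_cover_def simple_graph_def)
  then show ?thesis
    using that by auto
qed

text \<open>An independent set inside a smallest vertex cover has at most as many vertices as the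
  cover.\<close>

lemma alpha_vc_le_vc:
  assumes "simple_graph G"
  shows "alpha_vc G \<le> vc G"
proof -
  obtain S where S: "vertex_cover G S" "card S = vc G"
    using vc_witness[OF assms] .
  have sub: "S \<subseteq> verts G" and fin: "finite (verts G)"
    using S assms by (auto simp: vertex_cover_def simple_graph_def)
  obtain T where "independent (induced G S) T" "card T = independence_number (induced G S)"
    using independence_number_witness[OF finite_verts_induced[OF fin sub]] .
  then have "independence_number (induced G S) \<le> card S"
    using sub fin card_mono[of S T] finite_subset
    by (auto simp: independent_def induced_def)
  then show ?thesis
    using alpha_vc_le[OF fin S(1)] S(2) by simp
qed

lemma le_alpha_vcI:
  assumes "simple_graph G"
    and "\<And>S. vertex_cover G S \<Longrightarrow> \<exists>T\<subseteq>S. independent G T \<and> card T = n"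
  shows "n \<le> alpha_vc G"
proof -
  obtain S where S: "vertex_cover G S" "independence_number (induced G S) = alpha_vc G"
    using alpha_vc_witness[OF assms(1)] .
  have sub: "S \<subseteq> verts G" and fin: "finite (verts G)"
    using S assms by (auto simp: vertex_cover_def simple_graph_def)
  obtain T where "T \<subseteq> S" "independent G T" "card T = n"
    using assms(2)[OF S(1)] by auto
  then have "n \<le> independence_number (induced G S)"
    using card_le_independence_number[OF finite_verts_induced[OF fin sub], of T]
    by (simp add: independent_induced_iff[OF sub])
  then show ?thesis
    using S(2) by simp
qed

section \<open>Covers and cliques of \<open>nK2 n\<close> and \<open>Knn n\<close>\<close>

text \<open>A cover contains an endpoint of each of the \<open>n\<close> edges, and one endpoint
  from each edge gives an independent set.\<close>

lemma le_alpha_vc_nK2: "n \<le> alpha_vc (nK2 n)"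
proof (rule le_alpha_vcI[OF simple_graph_nK2])
  fix S assume S: "vertex_cover (nK2 n) S"
  \<comment> \<open>For \<open>i < n\<close> the fallback \<open>2 * i + 1\<close> lies in
    \<open>S\<close> because the edge has to be covered.\<close>
  define t where "t i = (if 2 * i \<in> S then 2 * i else 2 * i + 1)" for i
  have t_div: "t i div 2 = i" for i
    by (auto simp: t_def)
  have inj: "inj_on t {..<n}"
    by (metis inj_onI t_div)
  have t_in: "t i \<in> S" if "i < n" for i
  proof -
    have "{2 * i, 2 * i + 1} \<in> edges (nK2 n)"
      using that by (auto simp: nK2_def)
    then show ?thesis
      using S by (force simp: vertex_cover_def t_def)
  qed
  have lt: "t i < 2 * n" if "i < n" for i
    using that by (auto simp: t_def)
  have "independent (nK2 n) (t ` {..<n})"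
    unfolding independent_def
  proof (intro conjI ballI)
    show "t ` {..<n} \<subseteq> verts (nK2 n)"
      using lt by (auto simp: nK2_def)
    fix x y assume "x \<in> t ` {..<n}" "y \<in> t ` {..<n}"
    then show "{x, y} \<notin> edges (nK2 n)"
      using lt by (auto simp: edge_nK2_iff t_div)
  qed
  then show "\<exists>T\<subseteq>S. independent (nK2 n) T \<and> card T = n"
    using t_in inj by (intro exI[of _ "t ` {..<n}"]) (auto simp: card_image)
qed

text \<open>A cover contains a whole side, since vertices missing from both sides would span an
  uncovered edge; and each side is independent.\<close>

lemma le_alpha_vc_Knn: "n \<le> alpha_vc (Knn n)"
proof (rule le_alpha_vcI[OF simple_graph_Knn])
  fix S assume S: "vertex_cover (Knn n) S"
  have "i \<in> S \<or> n + j \<in> S" if "i < n" "j < n" for i j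
  proof -
    have "{i, n + j} \<in> edges (Knn n)"
      using that by (auto simp: Knn_def)
    then show ?thesis
      using S by (force simp: vertex_cover_def)
  qed
  then consider "\<forall>i<n. i \<in> S" | "\<forall>j<n. n + j \<in> S"
    by blast
  then show "\<exists>T\<subseteq>S. independent (Knn n) T \<and> card T = n"
  proof cases
    case 1
    have "independent (Knn n) {..<n}"
      by (auto simp: independent_def edge_Knn_iff) (auto simp: Knn_def)
    then show ?thesis
      using 1 by (intro exI[of _ "{..<n}"]) auto
  next
    case 2
    have "x \<in> S" if "n \<le> x" "x < 2 * n" for x
      using 2[rule_format, of "x - n"] that by simp
    moreover have "independent (Knn n) {n..<2 * n}"
      by (auto simp: independent_def edge_Knn_iff) (auto simp: Knn_def)
    ultimately show ?thesis
      by (intro exI[of _ "{n..<2 * n}"]) auto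
  qed
qed

text \<open>A clique with at least three vertices contains a triangle, which the second assumption
  excludes.\<close>

lemma clique_number_le_2I:
  assumes "finite (verts G)"
    and "\<And>x y z. x \<in> verts G \<Longrightarrow> y \<in> verts G \<Longrightarrow> z \<in> verts G \<Longrightarrow> x \<noteq> y \<Longrightarrow> x \<noteq> z \<Longrightarrow> y \<noteq> z \<Longrightarrow>
      {x, y} \<in> edges G \<Longrightarrow> {x, z} \<in> edges G \<Longrightarrow> {y, z} \<in> edges G \<Longrightarrow> False"
  shows "clique_number G \<le> 2"
proof (rule ccontr)
  assume "\<not> clique_number G \<le> 2"
  moreover obtain T where T: "Defs.clique G T" "card T = clique_number G"
    using clique_number_witness[OF assms(1)] .
  ultimately have "3 \<le> card T"
    by simp
  then obtain U where "U \<subseteq> T" "card U = 3"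
    using obtain_subset_with_card_n by metis
  then obtain x y z where "x \<in> T" "y \<in> T" "z \<in> T" "x \<noteq> y" "x \<noteq> z" "y \<noteq> z"
    by (auto simp: card_3_iff)
  then show False
    using T(1) assms(2)[of x y z] by (auto simp: Defs.clique_def)
qed

lemma clique_number_nK2_le: "clique_number (nK2 n) \<le> 2"
proof (rule clique_number_le_2I)
  show "finite (verts (nK2 n))"
    by (simp add: nK2_def)
  fix x y z assume "x \<in> verts (nK2 n)" "y \<in> verts (nK2 n)" "z \<in> verts (nK2 n)"
  then have "x < 2 * n" "y < 2 * n" "z < 2 * n"
    by (auto simp: nK2_def)
  moreover assume "x \<noteq> y" "x \<noteq> z" "y \<noteq> z"
    "{x, y} \<in> edges (nK2 n)" "{x, z} \<in> edges (nK2 n)" "{y, z} \<in> edges (nK2 n)"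
  ultimately have "x div 2 = y div 2 \<and> x div 2 = z div 2"
    by (simp add: edge_nK2_iff)
  \<comment> \<open>Three numbers cannot have pairwise different parities.\<close>
  moreover have "even u \<noteq> even v" if "u div 2 = v div 2" "u \<noteq> v" for u v :: nat
    using that by presburger
  ultimately show False
    using \<open>x \<noteq> y\<close> \<open>x \<noteq> z\<close> \<open>y \<noteq> z\<close> by metis
qed

lemma clique_number_Knn_le: "clique_number (Knn n) \<le> 2"
proof (rule clique_number_le_2I)
  show "finite (verts (Knn n))"
    by (simp add: Knn_def)
  fix x y z assume "x \<in> verts (Knn n)" "y \<in> verts (Knn n)" "z \<in> verts (Knn n)"
  then have "x < 2 * n" "y < 2 * n" "z < 2 * n"
    by (auto simp: Knn_def)
  moreover assume "{x, y} \<in> edges (Knn n)" "{x, z} \<in> edges (Knn n)" "{y, z} \<in> edges (Knn n)"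
  ultimately show False
    by (auto simp: edge_Knn_iff)
qed

section \<open>Excluded induced subgraphs bound \<open>alpha_vc\<close>\<close>

lemma matching_into_maximum_independent:
  assumes fin: "finite (verts G)"
    and I: "independent G I" "card I = independence_number G"
    and J: "independent G J" "I \<inter> J = {}"
  obtains M where "M \<subseteq> J \<times> I" "\<And>x y. (x, y) \<in> M \<Longrightarrow> {x, y} \<in> edges G"
    "inj_on fst M" "inj_on snd M" "card J \<le> 2 * card M"
proof -
  \<comment> \<open>An edge is stored as a pair with its end in \<open>J\<close> first; since
    \<open>I\<close> and \<open>J\<close> are disjoint, injectivity of both projections says that
    the edges are pairwise disjoint.\<close>
  define is_matching where "is_matching M \<longleftrightarrow> M \<subseteq> J \<times> I \<and> (\<forall>(x, y)\<in>M. {x, y} \<in> edges G) \<and>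
    inj_on fst M \<and> inj_on snd M" for M
  have finI: "finite I" and finJ: "finite J"
    using I(1) J(1) fin by (auto simp: independent_def intro: finite_subset)
  have "finite {M. is_matching M}"
    by (rule finite_subset[of _ "Pow (J \<times> I)"]) (auto simp: is_matching_def finI finJ)
  moreover have "{} \<in> {M. is_matching M}"
    by (simp add: is_matching_def)
  ultimately obtain M where M: "is_matching M" and max: "\<And>M'. is_matching M' \<Longrightarrow> M \<subseteq> M' \<Longrightarrow> M = M'"
    using finite_has_maximal2[of "{M. is_matching M}" "{}"] by auto
  have finM: "finite M"
    using M finI finJ finite_subset[of M "J \<times> I"] by (simp add: is_matching_def)
  have sub: "fst ` M \<subseteq> J" "snd ` M \<subseteq> I"
    using M by (auto simp: is_matching_def)
  have cards: "card (fst ` M) = card M" "card (snd ` M) = card M"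
    using M by (auto simp: is_matching_def card_image)
  \<comment> \<open>This is the set obtained from \<open>I\<close> by the exchange.\<close>
  define A where "A = (I - snd ` M) \<union> (J - fst ` M)"
  \<comment> \<open>An edge between unmatched vertices could be added to \<open>M\<close>, against
    its maximality under inclusion.\<close>
  have cross: "{x, y} \<notin> edges G" if x: "x \<in> J - fst ` M" and y: "y \<in> I - snd ` M" for x y
  proof
    assume "{x, y} \<in> edges G"
    then have "is_matching (insert (x, y) M)"
      using M x y by (auto simp: is_matching_def)
    then have "(x, y) \<in> M"
      using max by blast
    then show False
      using x by force
  qed
  have "{x, y} \<notin> edges G" if "x \<in> A" "y \<in> A" for x y
    using that cross[of x y] cross[of y x] I(1) J(1)
    by (auto simp: A_def independent_def insert_commute)
  moreover have "A \<subseteq> verts G"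
    using I(1) J(1) by (auto simp: A_def independent_def)
  ultimately have "independent G A"
    by (simp add: independent_def)
  then have "card A \<le> card I"
    using card_le_independence_number[OF fin] I(2) by simp
  moreover have "card A = card (I - snd ` M) + card (J - fst ` M)"
    unfolding A_def using J(2) finI finJ by (intro card_Un_disjoint) auto
  moreover have "card (I - snd ` M) = card I - card M" "card (J - fst ` M) = card J - card M"
    using sub finM cards by (simp_all add: card_Diff_subset)
  moreover have "card M \<le> card I"
    using card_mono[OF finI sub(2)] cards by simp
  ultimately have "card J \<le> 2 * card M"
    by linarith
  then show ?thesis
    using M by (intro that[of M]) (auto simp: is_matching_def)
qed

text \<open>The bound is twice the matching size required by \<open>matching_embeds\<close>, because
  the matching into a maximum independent set \<open>I\<close> may cover only half of an independent
  set outside \<open>I\<close>.\<close>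

lemma alpha_vc_bounded_if_not_embeds:
  obtains N where "\<And>G :: 'a graph. simple_graph G \<Longrightarrow> \<not> embeds (nK2 n) G \<Longrightarrow>
    \<not> embeds (Knn n) G \<Longrightarrow> alpha_vc G \<le> N"
proof -
  obtain N :: nat where N: "\<And>(G :: 'a graph) a b. inj_on a {..<N} \<Longrightarrow> inj_on b {..<N} \<Longrightarrow>
     a ` {..<N} \<inter> b ` {..<N} = {} \<Longrightarrow> independent G (a ` {..<N}) \<Longrightarrow> independent G (b ` {..<N}) \<Longrightarrow>
     (\<And>i. i < N \<Longrightarrow> {a i, b i} \<in> edges G) \<Longrightarrow> embeds (nK2 n) G \<or> embeds (Knn n) G"
    using matching_embeds[of n] by metis
  show ?thesis
  proof (rule that[of "2 * N"], rule ccontr)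
    fix G :: "'a graph"
    assume G: "simple_graph G" and no: "\<not> embeds (nK2 n) G" "\<not> embeds (Knn n) G"
      and "\<not> alpha_vc G \<le> 2 * N"
    have fin: "finite (verts G)"
      using G by (simp add: simple_graph_def)
    obtain I where I: "independent G I" "card I = independence_number G"
      using independence_number_witness[OF fin] .
    define S where "S = verts G - I"
    have sub: "S \<subseteq> verts G"
      by (auto simp: S_def)
    \<comment> \<open>No edge has both ends in the independent set \<open>I\<close>.\<close>
    have "e \<inter> S \<noteq> {}" if e: "e \<in> edges G" for e
    proof -
      obtain x y where "e = {x, y}" "x \<in> verts G" "y \<in> verts G"
        using e G by (force simp: simple_graph_def card_2_iff)
      then show ?thesis
        using e I(1) by (auto simp: S_def independent_def)
    qed
    then have "vertex_cover G S"
      using sub by (simp add: vertex_cover_def)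
    then have "alpha_vc G \<le> independence_number (induced G S)"
      using alpha_vc_le[OF fin] by simp
    moreover obtain J where J: "independent (induced G S) J"
      "card J = independence_number (induced G S)"
      using independence_number_witness[OF finite_verts_induced[OF fin sub]] .
    ultimately have card_J: "2 * N < card J"
      using \<open>\<not> alpha_vc G \<le> 2 * N\<close> by simp
    have J': "independent G J" "I \<inter> J = {}"
      using J(1) unfolding independent_induced_iff[OF sub] by (auto simp: S_def)
    obtain M where M: "M \<subseteq> J \<times> I" "\<And>x y. (x, y) \<in> M \<Longrightarrow> {x, y} \<in> edges G"
      "inj_on fst M" "inj_on snd M" "card J \<le> 2 * card M"
      using matching_into_maximum_independent[OF fin I J'] by metis
    have "N \<le> card M"
      using card_J M(5) by simp
    then obtain M' where M': "M' \<subseteq> M" "card M' = N" "finite M'"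
      by (rule obtain_subset_with_card_n)
    \<comment> \<open>The coordinates of this enumeration of \<open>N\<close> matching edges serve
      as the sequences a and b.\<close>
    then obtain h where h: "bij_betw h {..<N} M'"
      using ex_bij_betw_nat_finite[of M'] by (auto simp: lessThan_atLeast0)
    have inj: "inj_on (fst \<circ> h) {..<N}" "inj_on (snd \<circ> h) {..<N}"
      using h M(3,4) M'(1) by (auto simp: bij_betw_def intro!: comp_inj_on intro: inj_on_subset)
    have in_M: "h i \<in> M" if "i < N" for i
      using bij_betwE[OF h] M'(1) that by auto
    have img: "(fst \<circ> h) ` {..<N} \<subseteq> J" "(snd \<circ> h) ` {..<N} \<subseteq> I"
      using subsetD[OF M(1) in_M] by (auto simp: mem_Times_iff)
    have "embeds (nK2 n) G \<or> embeds (Knn n) G"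
    proof (rule N[OF inj])
      show "(fst \<circ> h) ` {..<N} \<inter> (snd \<circ> h) ` {..<N} = {}"
        using img J'(2) by blast
      show "independent G ((fst \<circ> h) ` {..<N})" "independent G ((snd \<circ> h) ` {..<N})"
        using img J'(1) I(1) unfolding independent_def by blast+
      fix i assume "i < N"
      then show "{(fst \<circ> h) i, (snd \<circ> h) i} \<in> edges G"
        using M(2)[of "fst (h i)" "snd (h i)"] in_M by simp
    qed
    then show False
      using no by simp
  qed
qed

section \<open>Bounding \<open>vc\<close> by \<open>alpha_vc\<close> and the clique number\<close>

text \<open>In a cover attaining \<open>alpha_vc G\<close>, independent sets have at most
  \<open>k\<close> vertices and cliques at most \<open>clique_number G\<close>, so Ramsey's theorem
  bounds the size of the cover itself.\<close>

lemma vc_bounded_by_alpha_vc_clique_number: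
  obtains f :: "nat \<Rightarrow> nat" where "mono f"
    "\<And>G :: 'a graph. simple_graph G \<Longrightarrow> alpha_vc G \<le> k \<Longrightarrow> vc G \<le> f (clique_number G)"
proof -
  \<comment> \<open>Both target sizes are one above what the cover can contain.\<close>
  have "\<forall>w. \<exists>r. \<forall>(V::'a set) E. finite V \<and> r \<le> card V \<longrightarrow>
      (\<exists>R \<subseteq> V. card R = Suc w \<and> Ramsey.clique R E \<or> card R = Suc k \<and> indep R E)"
    using ramsey2 by metis
  then obtain r where r: "\<And>w (V::'a set) E. finite V \<Longrightarrow> r w \<le> card V \<Longrightarrow>
      \<exists>R \<subseteq> V. card R = Suc w \<and> Ramsey.clique R E \<or> card R = Suc k \<and> indep R E"
    by metis
  \<comment> \<open>The chosen Ramsey bounds \<open>r\<close> need not be monotone; their partial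
    sums are, and they dominate \<open>r\<close>.\<close>
  define f where "f w = (\<Sum>i\<le>w. r i)" for w
  show ?thesis
  proof
    show "mono f"
      unfolding f_def by (intro monoI sum_mono2) auto
    fix G :: "'a graph" assume G: "simple_graph G" and k: "alpha_vc G \<le> k"
    have fin: "finite (verts G)"
      using G by (simp add: simple_graph_def)
    obtain S where S: "vertex_cover G S" "independence_number (induced G S) = alpha_vc G"
      using alpha_vc_witness[OF G] .
    have sub: "S \<subseteq> verts G"
      using S(1) by (simp add: vertex_cover_def)
    have "card S \<le> r (clique_number G)"
    proof (rule ccontr)
      assume "\<not> card S \<le> r (clique_number G)"
      then obtain R where R: "R \<subseteq> S" and cases:
        "card R = Suc (clique_number G) \<and> Ramsey.clique R (edges G) \<or>
         card R = Suc k \<and> indep R (edges G)"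
        using r[of S "clique_number G" "edges G"] finite_subset[OF sub fin] by auto
      from cases show False
      proof
        assume *: "card R = Suc (clique_number G) \<and> Ramsey.clique R (edges G)"
        then have "Defs.clique G R"
          using R sub by (auto simp: Defs.clique_def Ramsey.clique_def)
        then show False
          using card_le_clique_number[OF fin] * by fastforce
      next
        assume *: "card R = Suc k \<and> indep R (edges G)"
        \<comment> \<open>\<open>indep\<close> speaks only of distinct vertices, whereas
          \<open>independent\<close> also excludes loops.\<close>
        have "{x, x} \<notin> edges G" for x
          using G by (auto simp: simple_graph_def)
        then have "independent G R"
          using * R sub unfolding independent_def indep_def by (metis subset_trans)
        then have "independent (induced G S) R"
          using R by (simp add: independent_induced_iff[OF sub])
        then show False
          using card_le_independence_number[OF finite_verts_induced[OF fin sub]] * S(2) k by fastforce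
      qed
    qed
    moreover have "r (clique_number G) \<le> f (clique_number G)"
      unfolding f_def by (intro member_le_sum) auto
    ultimately show "vc G \<le> f (clique_number G)"
      using vc_le[OF fin S(1)] by linarith
  qed
qed

section \<open>Equivalence of the three conditions for hereditary classes\<close>

theorem theorem5p28:
  fixes \<G> :: "nat graph set"
  assumes "hereditary \<G>"
  shows "(clique_bounded_vc \<G> \<longleftrightarrow> bounded_alpha_vc \<G>) \<and>
         (bounded_alpha_vc \<G> \<longleftrightarrow> (\<exists>n>0. nK2 n \<notin> \<G> \<and> Knn n \<notin> \<G>))"
proof -
  have simple: "simple_graph G" if "G \<in> \<G>" for G
    using assms that unfolding hereditary_def by blast
  have sub: "H \<in> \<G>" if "G \<in> \<G>" "induced_subgraph H G" for G H
    using assms that unfolding hereditary_def by blast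
  \<comment> \<open>With \<open>sub\<close>, this turns bounds on all induced subgraphs of members
    into bounds on the members.\<close>
  have self: "induced_subgraph G G" if "G \<in> \<G>" for G
    using induced_self[OF simple[OF that]] by (metis induced_subgraph_def order_refl)
  have "\<exists>n>0. nK2 n \<notin> \<G> \<and> Knn n \<notin> \<G>" if cb: "clique_bounded_vc \<G>"
  proof -
    obtain f :: "nat \<Rightarrow> nat" where "mono f" and
      f: "\<And>G. G \<in> \<G> \<Longrightarrow> vc G \<le> f (clique_number G)"
      using cb self unfolding clique_bounded_vc_def by metis
    have bound: "vc G \<le> f 2" if "G \<in> \<G>" "clique_number G \<le> 2" for G
      using f[OF that(1)] monoD[OF \<open>mono f\<close> that(2)] by simp
    \<comment> \<open>Members with clique number at most 2 have \<open>vc\<close> at most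
      \<open>f 2\<close>, while \<open>nK2 n\<close> and \<open>Knn n\<close> have \<open>vc\<close>
      at least \<open>n\<close>.\<close>
    define n where "n = Suc (f 2)"
    have "f 2 < vc (nK2 n)" "f 2 < vc (Knn n)"
      using le_alpha_vc_nK2[of n] alpha_vc_le_vc[OF simple_graph_nK2[of n]]
        le_alpha_vc_Knn[of n] alpha_vc_le_vc[OF simple_graph_Knn[of n]] by (simp_all add: n_def)
    then have "nK2 n \<notin> \<G>" "Knn n \<notin> \<G>"
      using bound clique_number_nK2_le clique_number_Knn_le by (meson not_le)+
    then show ?thesis
      by (intro exI[of _ n]) (simp add: n_def)
  qed
  moreover have "bounded_alpha_vc \<G>" if "nK2 n \<notin> \<G>" "Knn n \<notin> \<G>" for n
  proof -
    obtain N where N: "\<And>G :: nat graph. simple_graph G \<Longrightarrow> \<not> embeds (nK2 n) G \<Longrightarrow>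
        \<not> embeds (Knn n) G \<Longrightarrow> alpha_vc G \<le> N"
      using alpha_vc_bounded_if_not_embeds[of n] by metis
    \<comment> \<open>An excluded graph embedded in \<open>G\<close> would itself belong to the
      class.\<close>
    have "alpha_vc G \<le> N" if "G \<in> \<G>" for G
      using N[OF simple[OF that]] hereditary_embeds[OF assms that] simple_graph_nK2
        simple_graph_Knn \<open>nK2 n \<notin> \<G>\<close> \<open>Knn n \<notin> \<G>\<close> by metis
    then show ?thesis
      unfolding bounded_alpha_vc_def using sub by blast
  qed
  moreover have "clique_bounded_vc \<G>" if bav: "bounded_alpha_vc \<G>"
  proof -
    obtain k where k: "\<And>G. G \<in> \<G> \<Longrightarrow> alpha_vc G \<le> k"
      using bav self unfolding bounded_alpha_vc_def by metis
    obtain f :: "nat \<Rightarrow> nat" where "mono f" and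
      f: "\<And>G :: nat graph. simple_graph G \<Longrightarrow> alpha_vc G \<le> k \<Longrightarrow> vc G \<le> f (clique_number G)"
      using vc_bounded_by_alpha_vc_clique_number[of k] by metis
    then show ?thesis
      unfolding clique_bounded_vc_def using sub simple k by blast
  qed
  ultimately show ?thesis
    by blast
qed

end
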